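(* Let $n\ge1$ be an integer, let $a<b$ be real numbers, and let $p_1,\dots,p_n\in C^\infty[a,b]$. The causal Green's function on $[a,b]$ of the differential operator $$\mathcal{O}(x,\partial_x)=\big(\partial_x-p_1(x)\big)\big(\partial_x-p_2(x)\big)\cdots\big(\partial_x-p_n(x)\big)$$ (composition of operators) is $$G(x,y)=\theta(x-y)\int_y^xdz_1\int_y^{z_1}dz_2\cdots\int_y^{z_{n-2}}dz_{n-1}\Big(e^{\int_{z_1}^{x}dt_n\,p_n(t_n)}\,e^{\int_{z_2}^{z_1}dt_{n-1}\,p_{n-1}(t_{n-1})}\cdots e^{\int_y^{z_{n-1}}dt_1\,p_1(t_1)}\Big).$$
   Context: Functions are complex-valued functions of a real variable. $\theta$ is the Heaviside step function: $\theta(t)=1$ for $t>0$ and $\theta(t)=0$ for $t<0$ (the value at $0$ is immaterial; take $\theta(0)=1$). Integrals are oriented. For $n=1$ there is no integration over $z$'s and the formula reads $G(x,y)=\theta(x-y)e^{\int_y^x dt_1\,p_1(t_1)}$. Causal Green's function: for a monic linear differential operator $\mathcal{O}(x,\partial_x)$ of order $n\ge1$ with continuous coefficients on $[a,b]$, its causal Green's function (the Green's function for the boundary condition $\partial_x^i y(a)=0$, $i=0,\dots,n-1$) is the function $G(x,y)=T(x,y)\theta(x-y)$ on $[a,b]\times[a,b]$ where, for each fixed $y\in[a,b]$, $T(\cdot,y)$ is the unique $n$ times continuously differentiable function on $[a,b]$ with $\mathcal{O}(x,\partial_x)T(x,y)=0$, $(\partial_x^iT(x,y))|_{x=y}=0$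 for $i=0,\dots,n-2$, and $(\partial_x^{n-1}T(x,y))|_{x=y}=1$. *)

theory Defs
  imports "HOL-Analysis.Analysis"
begin

(* Derivative relative to the interval, hence one-sided at a and b.
   Values outside the interval carry no meaning. *)
definition deriv_on :: "real \<Rightarrow> real \<Rightarrow> (real \<Rightarrow> complex) \<Rightarrow> real \<Rightarrow> complex" where
  "deriv_on a b f = (\<lambda>x. vector_derivative f (at x within {a..b}))"

definition Cn_on :: "nat \<Rightarrow> real \<Rightarrow> real \<Rightarrow> (real \<Rightarrow> complex) \<Rightarrow> bool" where
  "Cn_on n a b f \<longleftrightarrow>
     (\<forall>k<n. (deriv_on a b ^^ k) f differentiable_on {a..b}) \<and>
     continuous_on {a..b} ((deriv_on a b ^^ n) f)"

definition Cinf_on :: "real \<Rightarrow> real \<Rightarrow> (real \<Rightarrow> complex) \<Rightarrow> bool" where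
  "Cinf_on a b f \<longleftrightarrow> (\<forall>n. Cn_on n a b f)"

(* Operators act on total functions; only their action on functions that are
   n times continuously differentiable on [a,b], evaluated on [a,b], is meaningful. *)
type_synonym diff_op = "(real \<Rightarrow> complex) \<Rightarrow> real \<Rightarrow> complex"

definition monic_linear_diff_op :: "nat \<Rightarrow> real \<Rightarrow> real \<Rightarrow> diff_op \<Rightarrow> bool" where
  "monic_linear_diff_op n a b L \<longleftrightarrow>
     (\<exists>c :: nat \<Rightarrow> real \<Rightarrow> complex.
        (\<forall>i<n. continuous_on {a..b} (c i)) \<and>
        (\<forall>f. Cn_on n a b f \<longrightarrow>
           (\<forall>x\<in>{a..b}. L f x =
              (deriv_on a b ^^ n) f x + (\<Sum>i<n. c i x * (deriv_on a b ^^ i) f x))))"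

definition causal_ivp :: "nat \<Rightarrow> real \<Rightarrow> real \<Rightarrow> diff_op \<Rightarrow> real \<Rightarrow> (real \<Rightarrow> complex) \<Rightarrow> bool" where
  "causal_ivp n a b L y f \<longleftrightarrow>
     Cn_on n a b f \<and>
     (\<forall>x\<in>{a..b}. L f x = 0) \<and>
     (\<forall>i<n - 1. (deriv_on a b ^^ i) f y = 0) \<and>
     (deriv_on a b ^^ (n - 1)) f y = 1"

definition heaviside :: "real \<Rightarrow> real" where
  "heaviside t = (if t \<ge> 0 then 1 else 0)"

definition is_causal_Green ::
  "nat \<Rightarrow> real \<Rightarrow> real \<Rightarrow> diff_op \<Rightarrow> (real \<Rightarrow> real \<Rightarrow> complex) \<Rightarrow> bool" where
  "is_causal_Green n a b L G \<longleftrightarrow>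
     1 \<le> n \<and> monic_linear_diff_op n a b L \<and>
     (\<exists>T :: real \<Rightarrow> real \<Rightarrow> complex.
        (\<forall>y\<in>{a..b}. causal_ivp n a b L y (\<lambda>x. T x y) \<and>
           (\<forall>f. causal_ivp n a b L y f \<longrightarrow> (\<forall>x\<in>{a..b}. f x = T x y))) \<and>
        (\<forall>x\<in>{a..b}. \<forall>y\<in>{a..b}. G x y = T x y * of_real (heaviside (x - y))))"

definition first_order_op :: "real \<Rightarrow> real \<Rightarrow> (real \<Rightarrow> complex) \<Rightarrow> diff_op" where
  "first_order_op a b q f = (\<lambda>x. deriv_on a b f x - q x * f x)"

(* The leftmost factor, applied last, is the one with p 1. *)
definition factored_op :: "nat \<Rightarrow> real \<Rightarrow> real \<Rightarrow> (nat \<Rightarrow> real \<Rightarrow> complex) \<Rightarrow> diff_op" where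
  "factored_op n a b p = foldr (\<lambda>i L. first_order_op a b (p i) \<circ> L) [1..<Suc n] id"

(* int_y^u dz_1 int_y^{z_1} dz_2 ... int_y^{z_(m-1)} dz_m  F [z_1, ..., z_m] *)
fun nested_integral :: "nat \<Rightarrow> real \<Rightarrow> real \<Rightarrow> (real list \<Rightarrow> complex) \<Rightarrow> complex" where
  "nested_integral 0 y u F = F []"
| "nested_integral (Suc m) y u F =
     (LBINT z=y..u. nested_integral m y z (\<lambda>zs. F (z # zs)))"

(* With z_0 = x and z_n = y, the factor k = 1, ..., n is
   exp (int_{z_k}^{z_(k-1)} dt p_(n+1-k)(t)). *)
definition exp_product ::
  "nat \<Rightarrow> (nat \<Rightarrow> real \<Rightarrow> complex) \<Rightarrow> real \<Rightarrow> real \<Rightarrow> real list \<Rightarrow> complex" where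
  "exp_product n p x y zs =
     (let w = x # zs @ [y]
      in \<Prod>k=1..n. exp (LBINT t=w ! k..w ! (k - 1). p (n + 1 - k) t))"

end

theory Submission
  imports Defs
begin

text \<open>
  Split off the rightmost factor, the one that acts first, so that the operator is
  \<open>L \<circ> (\<partial> - q)\<close>, and put \<open>g = (\<partial> - q) f\<close>. The function \<open>f\<close> solves the causal initial value
  problem at \<open>y\<close> for \<open>L \<circ> (\<partial> - q)\<close>, of order \<open>n + 1\<close>, exactly when \<open>f\<close> is differentiable,
  \<open>f y = 0\<close> and \<open>g\<close> solves the causal problem at \<open>y\<close> for \<open>L\<close>, of order \<open>n \<ge> 1\<close>
  (\<open>causal_ivp_reduce\<close>). Indeed, as long as the derivatives of
  \<open>f\<close> at \<open>y\<close> of order at most \<open>i\<close> vanish, so do those of \<open>q f\<close>, and then the \<open>i\<close>-th derivative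
  of \<open>g\<close> at \<open>y\<close> is the \<open>(i + 1)\<close>-st derivative of \<open>f\<close>: the reduction shifts the initial data
  by one place.

  The remaining first-order problem \<open>f' = q f + g\<close>, \<open>f y = 0\<close>, has exactly one solution, given by
  Duhamel's formula as the integral from \<open>y\<close> to \<open>x\<close> of \<open>exp (\<integral>\<^sub>z\<^sup>x q) g z\<close>
  (\<open>first_order_ivp_iff\<close>). The nested integral satisfies the same recursion in the number of
  factors (\<open>nested_exp_product_Suc\<close>): the outermost exponential carries the coefficient of the
  rightmost factor, and the inner integral over \<open>z\<^sub>2, z\<^sub>3, \<dots>\<close> is the kernel of one order lower, at \<open>z\<^sub>1\<close>.

  Each step is an equivalence, so one induction (\<open>causal_ivp_factored_op_iff\<close>) shows that a function
  solves the causal problem if and only if it agrees on the interval with the nested integral, which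
  gives existence and uniqueness together. That the product of the factors is a monic operator
  with continuous coefficients is a separate induction, adding factors on the left
  (\<open>compositions_monic\<close>).
\<close>

section \<open>The derivative relative to the interval\<close>

context
  fixes a b :: real
  assumes ab: "a < b"
begin

lemma deriv_on_eqI:
  assumes "(f has_vector_derivative d) (at x within {a..b})" "x \<in> {a..b}"
  shows "deriv_on a b f x = d"
  using vector_derivative_within_cbox[of a b x f d] assms ab unfolding deriv_on_def by simp

lemma differentiable_on_imp_has_deriv_on:
  assumes "f differentiable_on {a..b}" "x \<in> {a..b}"
  shows "(f has_vector_derivative deriv_on a b f x) (at x within {a..b})"
  using assms unfolding deriv_on_def differentiable_on_def vector_derivative_works by blast

lemma differentiable_onI_vector:
  assumes "\<And>x. x \<in> {a..b} \<Longrightarrow> (f has_vector_derivative f' x) (at x within {a..b})"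
  shows "f differentiable_on {a..b}"
  using assms unfolding differentiable_on_def by (meson differentiableI_vector)

lemma has_vector_derivative_cong_on:
  assumes "\<And>x. x \<in> {a..b} \<Longrightarrow> f x = g x" "x \<in> {a..b}"
    "(f has_vector_derivative d) (at x within {a..b})"
  shows "(g has_vector_derivative d) (at x within {a..b})"
  using has_vector_derivative_transform[OF assms(2) _ assms(3)] assms(1) by simp

lemma deriv_on_cong:
  assumes "\<And>x. x \<in> {a..b} \<Longrightarrow> f x = g x" "x \<in> {a..b}"
  shows "deriv_on a b f x = deriv_on a b g x"
proof -
  have "(f has_vector_derivative d) (at x within {a..b}) \<longleftrightarrow>
        (g has_vector_derivative d) (at x within {a..b})" for d
    using has_vector_derivative_cong_on[of f g x d] has_vector_derivative_cong_on[of g f x d] assms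
    by auto
  then show ?thesis unfolding deriv_on_def vector_derivative_def by simp
qed

lemma differentiable_on_cong:
  fixes f g :: "real \<Rightarrow> complex"
  assumes "\<And>x. x \<in> {a..b} \<Longrightarrow> f x = g x"
  shows "f differentiable_on {a..b} \<longleftrightarrow> g differentiable_on {a..b}"
  using assms differentiable_transform_within[of f _ "{a..b}" 1 g]
    differentiable_transform_within[of g _ "{a..b}" 1 f]
  unfolding differentiable_on_def by (metis zero_less_one)

lemma deriv_on_funpow_cong:
  assumes "\<And>x. x \<in> {a..b} \<Longrightarrow> f x = g x" "x \<in> {a..b}"
  shows "(deriv_on a b ^^ k) f x = (deriv_on a b ^^ k) g x"
  using assms(2)
proof (induction k arbitrary: x)
  case (Suc k)
  then show ?case using deriv_on_cong[of "(deriv_on a b ^^ k) f" "(deriv_on a b ^^ k) g"] by simp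
qed (use assms in auto)

lemma deriv_on_add:
  assumes "f differentiable_on {a..b}" "g differentiable_on {a..b}" "x \<in> {a..b}"
  shows "deriv_on a b (\<lambda>x. f x + g x) x = deriv_on a b f x + deriv_on a b g x"
  using assms by (intro deriv_on_eqI derivative_intros differentiable_on_imp_has_deriv_on)

lemma deriv_on_mult:
  assumes "f differentiable_on {a..b}" "g differentiable_on {a..b}" "x \<in> {a..b}"
  shows "deriv_on a b (\<lambda>x. f x * g x) x = deriv_on a b f x * g x + f x * deriv_on a b g x"
  using has_vector_derivative_mult[OF differentiable_on_imp_has_deriv_on[OF assms(1,3)]
      differentiable_on_imp_has_deriv_on[OF assms(2,3)]] assms(3)
  by (auto intro!: deriv_on_eqI simp: add.commute)

lemma deriv_on_const: "x \<in> {a..b} \<Longrightarrow> deriv_on a b (\<lambda>_. c) x = 0"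
  by (intro deriv_on_eqI has_vector_derivative_const)

section \<open>Functions of class C^n on the interval\<close>

lemma Cn_on_0: "Cn_on 0 a b f \<longleftrightarrow> continuous_on {a..b} f"
  unfolding Cn_on_def by simp

lemma Cn_on_Suc:
  "Cn_on (Suc n) a b f \<longleftrightarrow> f differentiable_on {a..b} \<and> Cn_on n a b (deriv_on a b f)"
  unfolding Cn_on_def All_less_Suc2 by (simp add: funpow_swap1)

lemma Cn_on_SucD: "Cn_on (Suc n) a b f \<Longrightarrow> Cn_on n a b f"
  by (induction n arbitrary: f) (auto simp: Cn_on_Suc Cn_on_0 differentiable_imp_continuous_on)

lemma Cn_on_le:
  assumes "m \<le> n" "Cn_on n a b f"
  shows "Cn_on m a b f"
  using assms by (induction rule: inc_induct) (auto intro: Cn_on_SucD)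

lemma Cn_on_imp_continuous: "Cn_on n a b f \<Longrightarrow> continuous_on {a..b} f"
  using Cn_on_le[of 0 n f] by (simp add: Cn_on_0)

lemma Cn_on_cong:
  assumes "\<And>x. x \<in> {a..b} \<Longrightarrow> f x = g x"
  shows "Cn_on n a b f \<longleftrightarrow> Cn_on n a b g"
  using assms
proof (induction n arbitrary: f g)
  case 0
  then show ?case unfolding Cn_on_0 by (intro continuous_on_cong refl)
next
  case (Suc n)
  have "Cn_on n a b (deriv_on a b f) \<longleftrightarrow> Cn_on n a b (deriv_on a b g)"
    using Suc deriv_on_cong[of f g] by blast
  then show ?case using differentiable_on_cong[OF Suc.prems] by (simp add: Cn_on_Suc)
qed

lemma Cn_on_const: "Cn_on n a b (\<lambda>_. c)"
proof (induction n arbitrary: c)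
  case (Suc n)
  have "Cn_on n a b (deriv_on a b (\<lambda>_. c)) \<longleftrightarrow> Cn_on n a b (\<lambda>_. 0)"
    by (rule Cn_on_cong) (rule deriv_on_const)
  with Suc show ?case by (simp add: Cn_on_Suc)
qed (simp add: Cn_on_0)

lemma Cn_on_add:
  assumes "Cn_on n a b f" "Cn_on n a b g"
  shows "Cn_on n a b (\<lambda>x. f x + g x)"
  using assms
proof (induction n arbitrary: f g)
  case (Suc n)
  then have "Cn_on n a b (\<lambda>x. deriv_on a b f x + deriv_on a b g x)" by (simp add: Cn_on_Suc)
  moreover have "Cn_on n a b (deriv_on a b (\<lambda>x. f x + g x)) \<longleftrightarrow>
      Cn_on n a b (\<lambda>x. deriv_on a b f x + deriv_on a b g x)"
    using Suc.prems by (intro Cn_on_cong deriv_on_add) (auto simp: Cn_on_Suc)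
  ultimately show ?case using Suc.prems by (auto simp: Cn_on_Suc)
qed (auto simp: Cn_on_0 intro: continuous_intros)

lemma Cn_on_mult:
  assumes "Cn_on n a b f" "Cn_on n a b g"
  shows "Cn_on n a b (\<lambda>x. f x * g x)"
  using assms
proof (induction n arbitrary: f g)
  case (Suc n)
  have "Cn_on n a b (\<lambda>x. deriv_on a b f x * g x + f x * deriv_on a b g x)"
    using Suc.prems Suc.prems[THEN Cn_on_SucD] by (intro Cn_on_add Suc.IH) (auto simp: Cn_on_Suc)
  moreover have "Cn_on n a b (deriv_on a b (\<lambda>x. f x * g x)) \<longleftrightarrow>
      Cn_on n a b (\<lambda>x. deriv_on a b f x * g x + f x * deriv_on a b g x)"
    using Suc.prems by (intro Cn_on_cong deriv_on_mult) (auto simp: Cn_on_Suc)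
  ultimately show ?case using Suc.prems by (auto simp: Cn_on_Suc)
qed (auto simp: Cn_on_0 intro: continuous_intros)

lemma Cn_on_uminus: "Cn_on n a b f \<Longrightarrow> Cn_on n a b (\<lambda>x. - f x)"
  using Cn_on_mult[OF Cn_on_const[of n "-1"]] by simp

lemma Cn_on_diff: "Cn_on n a b f \<Longrightarrow> Cn_on n a b g \<Longrightarrow> Cn_on n a b (\<lambda>x. f x - g x)"
  using Cn_on_add[OF _ Cn_on_uminus] by simp

lemma Cinf_on_deriv_on: "Cinf_on a b f \<Longrightarrow> Cinf_on a b (deriv_on a b f)"
  unfolding Cinf_on_def using Cn_on_Suc by blast

lemma deriv_on_funpow_add:
  assumes "Cn_on k a b f" "Cn_on k a b g" "x \<in> {a..b}"
  shows "(deriv_on a b ^^ k) (\<lambda>x. f x + g x) x = (deriv_on a b ^^ k) f x + (deriv_on a b ^^ k) g x"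
  using assms
proof (induction k arbitrary: f g)
  case (Suc k)
  have "(deriv_on a b ^^ Suc k) (\<lambda>x. f x + g x) x =
      (deriv_on a b ^^ k) (deriv_on a b (\<lambda>x. f x + g x)) x" by (simp add: funpow_swap1)
  also have "\<dots> = (deriv_on a b ^^ k) (\<lambda>x. deriv_on a b f x + deriv_on a b g x) x"
    using Suc.prems by (intro deriv_on_funpow_cong deriv_on_add) (auto simp: Cn_on_Suc)
  finally show ?case using Suc by (simp add: funpow_swap1 Cn_on_Suc)
qed simp

lemma deriv_on_sum:
  assumes "finite I" "\<And>i. i \<in> I \<Longrightarrow> f i differentiable_on {a..b}" "x \<in> {a..b}"
  shows "deriv_on a b (\<lambda>x. \<Sum>i\<in>I. f i x) x = (\<Sum>i\<in>I. deriv_on a b (f i) x)"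
  using assms by (intro deriv_on_eqI has_vector_derivative_sum differentiable_on_imp_has_deriv_on)

text \<open>
  By the product rule, multiplication by a smooth function preserves vanishing to a given order at a
  point. The induction avoids the full Leibniz formula: both summands of \<open>q' f + q f'\<close> are again
  products whose second factor vanishes to one order less.
\<close>

lemma deriv_on_funpow_mult_eq_0:
  assumes "Cn_on m a b q" "Cn_on m a b f" "y \<in> {a..b}"
    and "\<And>i. i \<le> m \<Longrightarrow> (deriv_on a b ^^ i) f y = 0"
  shows "(deriv_on a b ^^ m) (\<lambda>x. q x * f x) y = 0"
  using assms
proof (induction m arbitrary: q f)
  case 0
  then show ?case using 0(4)[of 0] by simp
next
  case (Suc m)
  have C: "Cn_on m a b q" "Cn_on m a b f" "Cn_on m a b (deriv_on a b q)" "Cn_on m a b (deriv_on a b f)"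
    using Suc.prems Suc.prems(1,2)[THEN Cn_on_SucD] by (auto simp: Cn_on_Suc)
  have "(deriv_on a b ^^ Suc m) (\<lambda>x. q x * f x) y =
      (deriv_on a b ^^ m) (deriv_on a b (\<lambda>x. q x * f x)) y" by (simp add: funpow_swap1)
  also have "\<dots> = (deriv_on a b ^^ m) (\<lambda>x. deriv_on a b q x * f x + q x * deriv_on a b f x) y"
    using Suc.prems by (intro deriv_on_funpow_cong deriv_on_mult) (auto simp: Cn_on_Suc)
  also have "\<dots> = (deriv_on a b ^^ m) (\<lambda>x. deriv_on a b q x * f x) y +
      (deriv_on a b ^^ m) (\<lambda>x. q x * deriv_on a b f x) y"
    using C Suc.prems by (intro deriv_on_funpow_add Cn_on_mult)
  also have "(deriv_on a b ^^ m) (\<lambda>x. deriv_on a b q x * f x) y = 0"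
    using C Suc.prems by (intro Suc.IH) auto
  also have "(deriv_on a b ^^ m) (\<lambda>x. q x * deriv_on a b f x) y = 0"
  proof (intro Suc.IH C)
    fix i assume "i \<le> m"
    then show "(deriv_on a b ^^ i) (deriv_on a b f) y = 0"
      using Suc.prems(4)[of "Suc i"] by (simp add: funpow_swap1)
  qed (use Suc.prems in auto)
  finally show ?case by simp
qed

section \<open>The product of first-order operators is monic\<close>

text \<open>
  Applying \<open>\<partial> - p\<close> on the left to \<open>\<Sum>i\<le>n. c\<^sub>i \<partial>\<^sup>i\<close> gives the coefficients
  \<open>c\<^sub>i' - p c\<^sub>i + c\<^sub>i\<^sub>-\<^sub>1\<close>, so the top coefficient stays 1. Since the new coefficients involve
  derivatives of the old ones, continuity is too weak an induction hypothesis, and the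
  coefficients are taken to be smooth.
\<close>

lemma compositions_monic:
  assumes "\<And>i. i \<in> set is \<Longrightarrow> Cinf_on a b (p i)"
  defines "L \<equiv> foldr (\<lambda>i L. first_order_op a b (p i) \<circ> L) is id"
  shows "\<exists>c. (\<forall>i. Cinf_on a b (c i)) \<and> c (length is) = (\<lambda>_. 1) \<and>
    (\<forall>f. Cn_on (length is) a b f \<longrightarrow>
       (\<forall>x\<in>{a..b}. L f x = (\<Sum>i\<le>length is. c i x * (deriv_on a b ^^ i) f x)))"
  using assms(1) unfolding L_def
proof (induction "is")
  case Nil
  show ?case by (rule exI[of _ "\<lambda>_ _. 1"]) (auto simp: Cinf_on_def intro: Cn_on_const)
next
  case (Cons j js)
  define n where "n = length js"
  define M where "M = foldr (\<lambda>i L. first_order_op a b (p i) \<circ> L) js id"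
  from Cons.IH[OF Cons.prems[OF list.set_intros(2)]] obtain c where
    c: "\<And>i. Cinf_on a b (c i)" "c n = (\<lambda>_. 1)" and M: "\<And>f x. Cn_on n a b f \<Longrightarrow> x \<in> {a..b} \<Longrightarrow> M f x = (\<Sum>i\<le>n. c i x * (deriv_on a b ^^ i) f x)"
    unfolding n_def[symmetric] M_def[symmetric] by blast
  define e where "e i x = (if i \<le> n then deriv_on a b (c i) x - p j x * c i x else 0)" for i x
  define d where "d i x = e i x + (case i of 0 \<Rightarrow> 0 | Suc k \<Rightarrow> c k x)" for i x
  have pj: "Cinf_on a b (p j)" using Cons.prems by simp
  have e: "Cn_on m a b (e i)" for i m
  proof (cases "i \<le> n")
    case True
    then show ?thesis unfolding e_def using c(1)[of i] pj Cinf_on_deriv_on[of "c i"]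
      by (auto intro!: Cn_on_diff Cn_on_mult simp: Cinf_on_def)
  next
    case False
    then have "e i = (\<lambda>_. 0)" by (simp add: e_def fun_eq_iff)
    then show ?thesis by (simp add: Cn_on_const)
  qed
  have d: "Cn_on m a b (d i)" for i m
    unfolding d_def by (cases i) (use c(1) e in \<open>auto intro!: Cn_on_add simp: Cinf_on_def\<close>)
  have "(first_order_op a b (p j) \<circ> M) f x = (\<Sum>i\<le>Suc n. d i x * (deriv_on a b ^^ i) f x)"
    if f: "Cn_on (Suc n) a b f" and x: "x \<in> {a..b}" for f x
  proof -
    let ?D = "deriv_on a b"
    have Dc: "c i differentiable_on {a..b}" for i
      using c(1)[of i] Cn_on_Suc[of 0] unfolding Cinf_on_def by blast
    have Df: "(?D ^^ i) f differentiable_on {a..b}" if "i \<le> n" for i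
      using f that unfolding Cn_on_def by simp
    have "?D (M f) x = ?D (\<lambda>x. \<Sum>i\<le>n. c i x * (?D ^^ i) f x) x"
      using M[OF Cn_on_SucD[OF f]] x by (rule deriv_on_cong)
    also have "\<dots> = (\<Sum>i\<le>n. ?D (\<lambda>x. c i x * (?D ^^ i) f x) x)"
      using Dc Df x by (intro deriv_on_sum differentiable_on_mult) auto
    also have "\<dots> = (\<Sum>i\<le>n. ?D (c i) x * (?D ^^ i) f x + c i x * (?D ^^ Suc i) f x)"
      using Dc Df x by (intro sum.cong refl) (simp add: deriv_on_mult)
    finally have "(first_order_op a b (p j) \<circ> M) f x =
        (\<Sum>i\<le>n. ?D (c i) x * (?D ^^ i) f x + c i x * (?D ^^ Suc i) f x)
        - p j x * (\<Sum>i\<le>n. c i x * (?D ^^ i) f x)"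
      using M[OF Cn_on_SucD[OF f] x] by (simp add: first_order_op_def)
    also have "\<dots> = (\<Sum>i\<le>n. e i x * (?D ^^ i) f x) + (\<Sum>i\<le>n. c i x * (?D ^^ Suc i) f x)"
      by (simp add: e_def sum.distrib sum_distrib_left algebra_simps sum_subtractf)
    also have "(\<Sum>i\<le>n. e i x * (?D ^^ i) f x) = (\<Sum>i\<le>Suc n. e i x * (?D ^^ i) f x)"
      by (simp add: e_def)
    also have "(\<Sum>i\<le>n. c i x * (?D ^^ Suc i) f x) =
        (\<Sum>i\<le>Suc n. (case i of 0 \<Rightarrow> 0 | Suc k \<Rightarrow> c k x) * (?D ^^ i) f x)"
      by (simp add: sum.atMost_Suc_shift del: sum.atMost_Suc)
    finally show ?thesis by (simp only: d_def distrib_right sum.distrib)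
  qed
  moreover have "d (Suc n) = (\<lambda>_. 1)" unfolding d_def e_def by (simp add: c(2))
  ultimately show ?case
    using d unfolding n_def M_def foldr_Cons o_apply length_Cons Cinf_on_def by blast
qed

lemma factored_op_monic:
  assumes "\<And>i. i \<in> {1..n} \<Longrightarrow> Cinf_on a b (p i)"
  shows "monic_linear_diff_op n a b (factored_op n a b p)"
proof -
  have "\<And>i. i \<in> set [1..<Suc n] \<Longrightarrow> Cinf_on a b (p i)"
    using assms by (simp del: upt_Suc)
  from compositions_monic[of "[1..<Suc n]" p, OF this] obtain c where
    c: "\<And>i. Cinf_on a b (c i)" "c n = (\<lambda>_. 1)" and
    L: "\<And>f x. Cn_on n a b f \<Longrightarrow> x \<in> {a..b} \<Longrightarrow>
      factored_op n a b p f x = (\<Sum>i\<le>n. c i x * (deriv_on a b ^^ i) f x)"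
    unfolding factored_op_def length_upt diff_Suc_1 by blast
  have "continuous_on {a..b} (c i)" for i
    using c(1)[of i] Cn_on_imp_continuous unfolding Cinf_on_def by blast
  then show ?thesis unfolding monic_linear_diff_op_def
    by (intro exI[of _ c]) (simp add: L c(2) flip: lessThan_Suc_atMost)
qed

section \<open>First-order initial value problems\<close>

text \<open>
  Equality on the whole of \<open>[a, b]\<close> is required so that the lemma serves both orientations of the
  integral.
\<close>

lemma interval_integral_cong_on:
  fixes f g :: "real \<Rightarrow> complex"
  assumes "y \<in> {a..b}" "x \<in> {a..b}" "\<And>z. z \<in> {a..b} \<Longrightarrow> f z = g z"
  shows "(LBINT z=y..x. f z) = (LBINT z=y..x. g z)"
  using assms by (intro interval_integral_cong) (auto simp: einterval_iff min_def max_def split: if_splits)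

lemma interval_integral_diff_on:
  fixes q :: "real \<Rightarrow> complex"
  assumes "continuous_on {a..b} q" "y \<in> {a..b}" "z \<in> {a..b}" "x \<in> {a..b}"
  shows "(LBINT t=z..x. q t) = (LBINT t=y..x. q t) - (LBINT t=y..z. q t)"
proof -
  have "interval_lebesgue_integrable lborel (min (ereal y) (min (ereal z) (ereal x)))
      (max (ereal y) (max (ereal z) (ereal x))) q"
    unfolding ereal_min[symmetric] ereal_max[symmetric]
    using assms
    by (intro interval_integrable_continuous_on continuous_on_subset[OF assms(1)])
      (auto simp: min_def max_def)
  from interval_integral_sum[OF this] show ?thesis by (simp add: algebra_simps)
qed

text \<open>
  Duhamel's formula. With the integrating factor \<open>exp (- P)\<close>, where \<open>P' = q\<close> and \<open>P y = 0\<close>, the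
  equation becomes \<open>(exp (- P) f)' = exp (- P) g\<close>, and its solutions are the antiderivatives of the
  right-hand side. The initial value \<open>c\<close> is arbitrary because the kernel of order one starts at 1
  with \<open>g = 0\<close>, and each later one starts at 0.
\<close>

lemma first_order_ivp_iff:
  assumes q: "continuous_on {a..b} q" and g: "continuous_on {a..b} g" and y: "y \<in> {a..b}"
  shows "f differentiable_on {a..b} \<and> (\<forall>x\<in>{a..b}. first_order_op a b q f x = g x) \<and> f y = c \<longleftrightarrow>
    (\<forall>x\<in>{a..b}. f x = c * exp (LBINT t=y..x. q t) + (LBINT z=y..x. exp (LBINT t=z..x. q t) * g z))"
    (is "?ivp f \<longleftrightarrow> (\<forall>x\<in>{a..b}. f x = ?F x)")
proof -
  define P where "P x = (LBINT t=y..x. q t)" for x :: real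
  define U where "U x = (LBINT z=y..x. exp (- P z) * g z)" for x :: real
  have P: "(P has_vector_derivative q x) (at x within {a..b})" if "x \<in> {a..b}" for x
    using interval_integral_FTC2[of a y b q x] y that q unfolding P_def by simp
  then have contP: "continuous_on {a..b} P" by (rule continuous_on_vector_derivative)
  have U: "(U has_vector_derivative exp (- P x) * g x) (at x within {a..b})" if "x \<in> {a..b}" for x
    unfolding U_def using y that g contP
    by (intro interval_integral_FTC2) (auto intro!: continuous_intros)
  have E: "((\<lambda>x. exp (s * P x)) has_vector_derivative s * q x * exp (s * P x)) (at x within {a..b})"
    if "x \<in> {a..b}" for x s
    using field_vector_diff_chain_within[of "\<lambda>x. s * P x" "s * q x" x "{a..b}" exp "exp (s * P x)"]
      has_vector_derivative_mult_right[OF P[OF that], of s]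
    by (auto simp: o_def intro: DERIV_exp has_field_derivative_at_within)
  have F: "?F x = exp (P x) * (c + U x)" if x: "x \<in> {a..b}" for x
  proof -
    have "(LBINT z=y..x. exp (LBINT t=z..x. q t) * g z) = (LBINT z=y..x. exp (P x) * (exp (- P z) * g z))"
    proof (rule interval_integral_cong_on[OF y x])
      fix z assume "z \<in> {a..b}"
      then have "(LBINT t=z..x. q t) = P x + - P z"
        using interval_integral_diff_on[OF q y _ x] unfolding P_def by simp
      then show "exp (LBINT t=z..x. q t) * g z = exp (P x) * (exp (- P z) * g z)"
        by (simp only: exp_add mult.assoc)
    qed
    also have "\<dots> = exp (P x) * U x" unfolding U_def by simp
    finally show ?thesis by (simp only: P_def[symmetric] distrib_left mult.commute[of c])
  qed
  have [simp]: "P y = 0" "U y = 0" unfolding P_def U_def by simp_all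
  show ?thesis
  proof
    assume f: "?ivp f"
    \<comment> \<open>The factor \<open>- 1\<close> matches the form of \<open>E\<close>, which serves both signs of the exponent.\<close>
    define h where "h x = exp (- 1 * P x) * f x - U x" for x
    have "(h has_vector_derivative 0) (at x within {a..b})" if x: "x \<in> {a..b}" for x
    proof -
      have "(f has_vector_derivative g x + q x * f x) (at x within {a..b})"
        using differentiable_on_imp_has_deriv_on[of f x] f x
        unfolding first_order_op_def by (metis diff_add_cancel)
      from has_vector_derivative_diff[OF has_vector_derivative_mult[OF E[OF x, of "-1"] this] U[OF x]]
      show ?thesis unfolding h_def by (simp add: algebra_simps)
    qed
    then obtain k where k: "\<And>x. x \<in> {a..b} \<Longrightarrow> h x = k"
      using has_vector_derivative_zero_constant[of "{a..b}" h] by (metis convex_closed_interval)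
    from k[OF y] f have "k = c" by (simp add: h_def)
    show "\<forall>x\<in>{a..b}. f x = ?F x"
    proof
      fix x assume x: "x \<in> {a..b}"
      from k[OF x] \<open>k = c\<close> have "exp (- P x) * f x = c + U x" by (simp add: h_def algebra_simps)
      then have "f x = exp (P x) * (c + U x)"
        by (metis exp_minus_inverse mult.assoc mult_1)
      then show "f x = ?F x" using F[OF x] by simp
    qed
  next
    assume f: "\<forall>x\<in>{a..b}. f x = ?F x"
    have D: "(f has_vector_derivative q x * f x + g x) (at x within {a..b})" if x: "x \<in> {a..b}" for x
    proof (rule has_vector_derivative_cong_on[where f = "\<lambda>x. exp (1 * P x) * (c + U x)"])
      show "((\<lambda>x. exp (1 * P x) * (c + U x)) has_vector_derivative q x * f x + g x) (at x within {a..b})"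
        using has_vector_derivative_mult[OF E[OF x, of 1]
            has_vector_derivative_add[OF has_vector_derivative_const[of c] U[OF x]]] f F x
        by (simp add: exp_minus field_simps)
    qed (use f F x in auto)
    then have "f differentiable_on {a..b}" by (rule differentiable_onI_vector)
    moreover have "first_order_op a b q f x = g x" if "x \<in> {a..b}" for x
      using deriv_on_eqI[OF D[OF that] that] by (simp add: first_order_op_def)
    moreover have "f y = c" using f F y by simp
    ultimately show "?ivp f" by blast
  qed
qed

section \<open>Reduction of the order\<close>

text \<open>
  Regularity is gained by bootstrapping: \<open>f' = g + q f\<close> is as smooth as \<open>f\<close>, up to the smoothness
  of \<open>g\<close>.
\<close>

lemma Cn_on_Suc_iff_first_order_op:
  assumes q: "Cinf_on a b q" and f: "f differentiable_on {a..b}"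
  shows "Cn_on (Suc n) a b f \<longleftrightarrow> Cn_on n a b (first_order_op a b q f)"
proof
  have q: "Cn_on k a b q" for k using q unfolding Cinf_on_def by blast
  show "Cn_on n a b (first_order_op a b q f)" if "Cn_on (Suc n) a b f"
    unfolding first_order_op_def using that Cn_on_SucD[OF that]
    by (intro Cn_on_diff Cn_on_mult q) (simp_all add: Cn_on_Suc)
  assume g: "Cn_on n a b (first_order_op a b q f)"
  have "Cn_on k a b f" if "k \<le> Suc n" for k
    using that
  proof (induction k)
    case 0
    then show ?case using f by (simp add: Cn_on_0 differentiable_imp_continuous_on)
  next
    case (Suc k)
    then have "Cn_on k a b (\<lambda>x. first_order_op a b q f x + q x * f x)"
      using g by (intro Cn_on_add Cn_on_mult q) (auto intro: Cn_on_le)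
    then show ?case using f by (simp add: Cn_on_Suc first_order_op_def)
  qed
  then show "Cn_on (Suc n) a b f" by simp
qed

lemma deriv_on_funpow_first_order_op:
  assumes q: "Cinf_on a b q" and f: "Cn_on (Suc i) a b f" and y: "y \<in> {a..b}"
    and 0: "\<And>k. k \<le> i \<Longrightarrow> (deriv_on a b ^^ k) f y = 0"
  shows "(deriv_on a b ^^ i) (first_order_op a b q f) y = (deriv_on a b ^^ Suc i) f y"
proof -
  have q': "Cn_on i a b (\<lambda>x. - q x)" using q unfolding Cinf_on_def by (blast intro: Cn_on_uminus)
  have f': "Cn_on i a b f" "Cn_on i a b (deriv_on a b f)"
    using f Cn_on_SucD by (auto simp: Cn_on_Suc)
  have "(deriv_on a b ^^ i) (first_order_op a b q f) y =
      (deriv_on a b ^^ i) (\<lambda>x. deriv_on a b f x + - q x * f x) y"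
    by (simp add: first_order_op_def)
  also have "\<dots> = (deriv_on a b ^^ i) (deriv_on a b f) y"
    using deriv_on_funpow_add[OF f'(2) Cn_on_mult[OF q' f'(1)] y]
      deriv_on_funpow_mult_eq_0[OF q' f'(1) y 0] by simp
  finally show ?thesis by (simp add: funpow_swap1)
qed

text \<open>
  The shift of the initial data. From right to left the derivatives of \<open>f\<close> are recovered one at a
  time: once those up to order \<open>i\<close> vanish at \<open>y\<close>, the next one equals the \<open>i\<close>-th derivative
  of \<open>g\<close>.
\<close>

lemma initial_data_first_order_op:
  assumes q: "Cinf_on a b q" and f: "Cn_on (Suc n) a b f" and y: "y \<in> {a..b}" and n: "1 \<le> n"
  defines "g \<equiv> first_order_op a b q f"
  shows "(\<forall>i<n. (deriv_on a b ^^ i) f y = 0) \<and> (deriv_on a b ^^ n) f y = 1 \<longleftrightarrow>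
    f y = 0 \<and> (\<forall>i<n - 1. (deriv_on a b ^^ i) g y = 0) \<and> (deriv_on a b ^^ (n - 1)) g y = 1"
proof -
  have shift: "(deriv_on a b ^^ i) g y = (deriv_on a b ^^ Suc i) f y"
    if "i < n" "\<And>k. k \<le> i \<Longrightarrow> (deriv_on a b ^^ k) f y = 0" for i
    unfolding g_def using that f Cn_on_le[of "Suc i" "Suc n" f]
    by (intro deriv_on_funpow_first_order_op q y) auto
  show ?thesis
  proof safe
    assume 0: "\<forall>i<n. (deriv_on a b ^^ i) f y = 0" and 1: "(deriv_on a b ^^ n) f y = 1"
    show "f y = 0" using 0[rule_format, of 0] n by simp
    show "(deriv_on a b ^^ i) g y = 0" if "i < n - 1" for i
    proof -
      have "Suc i < n" using that by simp
      then have "(deriv_on a b ^^ i) g y = (deriv_on a b ^^ Suc i) f y"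
        using 0 by (intro shift) auto
      also have "\<dots> = 0" using 0 \<open>Suc i < n\<close> by blast
      finally show ?thesis .
    qed
    show "(deriv_on a b ^^ (n - 1)) g y = 1"
      using shift[of "n - 1"] 0 1 n by simp
  next
    assume f0: "f y = 0" and 0: "\<forall>i<n - 1. (deriv_on a b ^^ i) g y = 0"
      and 1: "(deriv_on a b ^^ (n - 1)) g y = 1"
    have *: "(deriv_on a b ^^ i) f y = 0" if "i < n" for i
      using that
    proof (induction i rule: less_induct)
      case (less i)
      show ?case
      proof (cases i)
        case (Suc k)
        have "(deriv_on a b ^^ k) g y = (deriv_on a b ^^ Suc k) f y"
          using less Suc by (intro shift) auto
        then show ?thesis using 0 less.prems Suc by simp
      qed (simp add: f0)
    qed
    then show "(deriv_on a b ^^ i) f y = 0" if "i < n" for i using that by blast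
    show "(deriv_on a b ^^ n) f y = 1" using shift[of "n - 1"] * 1 n by simp
  qed
qed

lemma causal_ivp_reduce:
  assumes "Cinf_on a b q" "y \<in> {a..b}" "1 \<le> n"
  shows "causal_ivp (Suc n) a b (L \<circ> first_order_op a b q) y f \<longleftrightarrow>
    f differentiable_on {a..b} \<and> f y = 0 \<and> causal_ivp n a b L y (first_order_op a b q f)"
proof (cases "Cn_on (Suc n) a b f")
  case True
  moreover from True have "f differentiable_on {a..b}" by (simp add: Cn_on_Suc)
  ultimately show ?thesis
    using initial_data_first_order_op[OF assms(1) True assms(2,3)]
      Cn_on_Suc_iff_first_order_op[OF assms(1), of f n]
    unfolding causal_ivp_def by auto
next
  case False
  then show ?thesis
    using Cn_on_Suc_iff_first_order_op[OF assms(1), of f n] unfolding causal_ivp_def by auto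
qed

end

section \<open>The causal Green's function as an iterated Duhamel integral\<close>

lemma nested_integral_mult_left:
  "nested_integral m y u (\<lambda>zs. c * F zs) = c * nested_integral m y u F"
  by (induction m arbitrary: u F) simp_all

text \<open>
  The list entry \<open>z\<close> plays the role of \<open>z\<^sub>1\<close>. Removing the first factor leaves the product of one
  order lower in which \<open>z\<close> takes the place of \<open>x\<close>.
\<close>

lemma exp_product_Cons:
  "exp_product (Suc n) p x y (z # zs) = exp (LBINT t=z..x. p (Suc n) t) * exp_product n p z y zs"
proof -
  define w where "w = map ereal (x # z # zs @ [y])"
  have "exp_product (Suc n) p x y (z # zs) =
      (\<Prod>k=1..Suc n. exp (LBINT t=w ! k..w ! (k - 1). p (Suc n + 1 - k) t))"
    by (simp add: exp_product_def Let_def w_def)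
  also have "\<dots> = exp (LBINT t=z..x. p (Suc n) t) *
      (\<Prod>k=Suc 1..Suc n. exp (LBINT t=w ! k..w ! (k - 1). p (Suc n + 1 - k) t))"
    by (subst prod.atLeast_Suc_atMost) (simp_all add: w_def)
  also have "(\<Prod>k=Suc 1..Suc n. exp (LBINT t=w ! k..w ! (k - 1). p (Suc n + 1 - k) t)) =
      (\<Prod>k=1..n. exp (LBINT t=w ! Suc k..w ! (Suc k - 1). p (Suc n + 1 - Suc k) t))"
    by (rule prod.shift_bounds_cl_Suc_ivl)
  also have "\<dots> = exp_product n p z y zs"
    unfolding exp_product_def Let_def by (intro prod.cong refl) (auto simp: w_def nth_Cons')
  finally show ?thesis .
qed

lemma nested_exp_product_Suc:
  "nested_integral (Suc m) y x (exp_product (Suc (Suc m)) p x y) =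
    (LBINT z=y..x. exp (LBINT t=z..x. p (Suc (Suc m)) t) * nested_integral m y z (exp_product (Suc m) p z y))"
  by (simp add: exp_product_Cons nested_integral_mult_left)

text \<open>
  The factors are listed from the leftmost one on, so the additional factor appears on the right and
  acts first.
\<close>

lemma factored_op_Suc:
  "factored_op (Suc n) a b p = factored_op n a b p \<circ> first_order_op a b (p (Suc n))"
proof -
  have "foldr (\<lambda>i L. first_order_op a b (p i) \<circ> L) is M =
      foldr (\<lambda>i L. first_order_op a b (p i) \<circ> L) is id \<circ> M" for "is" M
    by (induction "is") (simp_all add: comp_assoc)
  from this[of "[1..<Suc n]" "first_order_op a b (p (Suc n))"] show ?thesis
    unfolding factored_op_def using upt_Suc_append[of 1 "Suc n"] by (simp del: upt_Suc)
qed

text \<open>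
  Existence and uniqueness in one statement. Existence is also used inside the induction: the
  kernel of one order lower is itself a solution, hence continuous, as Duhamel's formula demands of
  its inhomogeneity. The induction starts at order one, where the condition with value 1 concerns
  \<open>f y\<close> itself.
\<close>

lemma causal_ivp_factored_op_iff:
  assumes "a < b" "y \<in> {a..b}" "\<And>i. i \<in> {1..Suc m} \<Longrightarrow> Cinf_on a b (p i)"
  shows "causal_ivp (Suc m) a b (factored_op (Suc m) a b p) y f \<longleftrightarrow>
    (\<forall>x\<in>{a..b}. f x = nested_integral m y x (exp_product (Suc m) p x y))"
  using assms(3)
proof (induction m arbitrary: f)
  case 0
  have p: "Cinf_on a b (p 1)" using 0 by simp
  then have q: "continuous_on {a..b} (p 1)"
    using Cn_on_imp_continuous[OF assms(1)] unfolding Cinf_on_def by blast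
  have "causal_ivp 1 a b (factored_op 1 a b p) y f \<longleftrightarrow>
    f differentiable_on {a..b} \<and> (\<forall>x\<in>{a..b}. first_order_op a b (p 1) f x = 0) \<and> f y = 1"
  proof -
    have "factored_op 1 a b p = first_order_op a b (p 1)" by (simp add: factored_op_def)
    moreover have "Cn_on 1 a b f"
      if "f differentiable_on {a..b}" "\<forall>x\<in>{a..b}. first_order_op a b (p 1) f x = 0"
    proof -
      have "continuous_on {a..b} (first_order_op a b (p 1) f) \<longleftrightarrow> continuous_on {a..b} (\<lambda>_. 0 :: complex)"
        using that(2) by (intro continuous_on_cong) auto
      then show ?thesis
        using Cn_on_Suc_iff_first_order_op[OF assms(1) p that(1), of 0] by (simp add: Cn_on_0[OF assms(1)])
    qed
    moreover have "f differentiable_on {a..b}" if "Cn_on 1 a b f"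
      using that Cn_on_Suc[OF assms(1), of 0] by simp
    ultimately show ?thesis unfolding causal_ivp_def by auto
  qed
  also have "\<dots> \<longleftrightarrow> (\<forall>x\<in>{a..b}. f x = exp (LBINT t=y..x. p 1 t))"
    using first_order_ivp_iff[OF assms(1) q, of "\<lambda>_. 0" y f 1] assms(2) by simp
  finally show ?case by (simp add: exp_product_def)
next
  case (Suc m)
  let ?N = "\<lambda>x. nested_integral m y x (exp_product (Suc m) p x y)"
  let ?q = "p (Suc (Suc m))"
  have IH: "causal_ivp (Suc m) a b (factored_op (Suc m) a b p) y g \<longleftrightarrow> (\<forall>x\<in>{a..b}. g x = ?N x)" for g
    using Suc by simp
  have q: "Cinf_on a b ?q" using Suc.prems by simp
  then have contq: "continuous_on {a..b} ?q"
    using Cn_on_imp_continuous[OF assms(1)] unfolding Cinf_on_def by blast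
  have "causal_ivp (Suc m) a b (factored_op (Suc m) a b p) y ?N" unfolding IH by simp
  then have contN: "continuous_on {a..b} ?N"
    using Cn_on_imp_continuous[OF assms(1)] unfolding causal_ivp_def by blast
  have "causal_ivp (Suc (Suc m)) a b (factored_op (Suc (Suc m)) a b p) y f \<longleftrightarrow>
      f differentiable_on {a..b} \<and> (\<forall>x\<in>{a..b}. first_order_op a b ?q f x = ?N x) \<and> f y = 0"
    unfolding factored_op_Suc[of "Suc m"]
    using causal_ivp_reduce[OF assms(1) q assms(2), of "Suc m"] IH by auto
  also have "\<dots> \<longleftrightarrow> (\<forall>x\<in>{a..b}. f x = (LBINT z=y..x. exp (LBINT t=z..x. ?q t) * ?N z))"
    using first_order_ivp_iff[OF assms(1) contq contN assms(2), of f 0] by simp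
  finally show ?case unfolding nested_exp_product_Suc .
qed

theorem corollary1:
  fixes n :: nat and a b :: real and p :: "nat \<Rightarrow> real \<Rightarrow> complex"
  assumes "1 \<le> n" and "a < b"
    and "\<And>i. i \<in> {1..n} \<Longrightarrow> Cinf_on a b (p i)"
  shows "is_causal_Green n a b (factored_op n a b p)
           (\<lambda>x y. of_real (heaviside (x - y)) * nested_integral (n - 1) y x (exp_product n p x y))"
proof -
  let ?T = "\<lambda>x y. nested_integral (n - 1) y x (exp_product n p x y)"
  have "causal_ivp n a b (factored_op n a b p) y f \<longleftrightarrow> (\<forall>x\<in>{a..b}. f x = ?T x y)"
    if "y \<in> {a..b}" for y f
    using causal_ivp_factored_op_iff[OF assms(2) that, of "n - 1" p f] assms(1,3) by simp
  then show ?thesis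
    unfolding is_causal_Green_def
    using assms(1) factored_op_monic[OF assms(2,3)]
    by (intro conjI exI[of _ ?T]) (simp_all add: mult.commute)
qed

end
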